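(* Let $p$ be analytic in $\mathbb{D}$ with $p(0)=1$. If $$zp'(z)+z^2p''(z)\prec\frac{3z}{8\sqrt{2}},$$ then $p(z)\prec\sqrt{1+z}$.
   Context: $\mathbb{D}=\{z\in\mathbb{C}:|z|<1\}$. For analytic $f,g$ on $\mathbb{D}$, $f\prec g$ ($f$ is subordinate to $g$) means there is an analytic $w:\mathbb{D}\to\mathbb{D}$ with $w(0)=0$ and $f(z)=g(w(z))$ for all $z\in\mathbb{D}$. $\sqrt{1+z}$ is the principal branch; it maps $\mathbb{D}$ univalently onto $\{w:|w^2-1|<1,\ \operatorname{Re}w>0\}$. *)

theory Defs
  imports "HOL-Complex_Analysis.Complex_Analysis"
begin

abbreviation unit_disc :: "complex set" where
  "unit_disc \<equiv> ball 0 1"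

text \<open>Subordination is a relation between analytic functions on the disc, so the analyticity of
  both functions is part of the predicate; values outside the disc are irrelevant.\<close>

definition subordinate :: "(complex \<Rightarrow> complex) \<Rightarrow> (complex \<Rightarrow> complex) \<Rightarrow> bool"
    (infix "\<prec>\<^sub>D" 50) where
  "f \<prec>\<^sub>D g \<longleftrightarrow> f analytic_on unit_disc \<and> g analytic_on unit_disc \<and>
     (\<exists>w. w analytic_on unit_disc \<and> w ` unit_disc \<subseteq> unit_disc \<and> w 0 = 0 \<and>
          (\<forall>z\<in>unit_disc. f z = g (w z)))"

end

theory Submission
  imports Defs
begin

text \<open>
  With \<open>q z = z p'(z)\<close> the hypothesis becomes \<open>z q'(z) = c w(z)\<close> for some Schwarz function \<open>w\<close>,
  where \<open>c = 3 / (8 sqrt 2) \<le> 3 / 8\<close>. The Schwarz lemma gives \<open>\<bar>z q'(z)\<bar> \<le> c \<bar>z\<bar>\<close>, and integrating twice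
  gives \<open>\<bar>p(z) - 1\<bar> \<le> c \<bar>z\<bar>\<close>. This is small enough for \<open>\<bar>p(z)\<^sup>2 - 1\<bar> < 1\<close> and \<open>Re p(z) > 0\<close>, so that
  \<open>p\<^sup>2 - 1\<close> witnesses the subordination.
\<close>

text \<open>Cancelling \<open>norm z\<close> bounds \<open>deriv f\<close> by \<open>c\<close> on
  the punctured disc, continuity carries this bound to the origin, and the mean value inequality on
  the convex disc integrates it along the segment from 0. This is the integration step, used first
  for \<open>q\<close> and then for \<open>p\<close>.\<close>

lemma norm_diff_le_of_norm_mult_deriv_le:
  assumes hol: "f holomorphic_on unit_disc"
    and bound: "\<And>z. z \<in> unit_disc \<Longrightarrow> norm (z * deriv f z) \<le> c * norm z"
    and z: "z \<in> unit_disc"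
  shows "norm (f z - f 0) \<le> c * norm z"
proof -
  have nz: "norm (deriv f x) \<le> c" if "x \<in> unit_disc" "x \<noteq> 0" for x
    using bound[OF that(1)] that(2) by (simp add: norm_mult mult.commute)
  \<comment> \<open>At 0 the assumption reads \<open>0 \<le> 0\<close>, so the bound there has to
    come as a limit.\<close>
  have "deriv f holomorphic_on unit_disc"
    by (simp add: hol holomorphic_deriv)
  then have "isCont (deriv f) 0"
    using continuous_on_eq_continuous_at holomorphic_on_imp_continuous_on
    by (metis centre_in_ball open_ball zero_less_one)
  then have "((\<lambda>x. norm (deriv f x)) \<longlongrightarrow> norm (deriv f 0)) (at 0)"
    by (intro tendsto_norm) (simp add: isCont_def)
  moreover have "\<forall>\<^sub>F x in at (0::complex). x \<in> unit_disc - {0}"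
    by (rule eventually_at_in_open) auto
  then have "\<forall>\<^sub>F x in at (0::complex). norm (deriv f x) \<le> c"
    by eventually_elim (use nz in auto)
  ultimately have "norm (deriv f 0) \<le> c"
    by (rule tendsto_upperbound) simp
  with nz have le: "norm (deriv f x) \<le> c" if "x \<in> unit_disc" for x
    using that by (cases "x = 0") auto
  have der: "(f has_field_derivative deriv f x) (at x within unit_disc)" if "x \<in> unit_disc" for x
    using holomorphic_derivI[OF hol _ that] by (simp add: has_field_derivative_at_within)
  show ?thesis
    using field_differentiable_bound[OF convex_ball der le z, of 0] by simp
qed

theorem lemma4p1:
  fixes p :: "complex \<Rightarrow> complex"
  assumes "p analytic_on unit_disc"
    and "p 0 = 1"
    and "(\<lambda>z. z * deriv p z + z\<^sup>2 * deriv (deriv p) z)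
           \<prec>\<^sub>D (\<lambda>z. 3 * z / (8 * complex_of_real (sqrt 2)))"
  shows "p \<prec>\<^sub>D (\<lambda>z. csqrt (1 + z))"
proof -
  define c :: real where "c = 3 / (8 * sqrt 2)"
  have "c > 0"
    by (simp add: c_def)
  \<comment> \<open>Since \<open>sqrt 2 \<ge> 1\<close>; this rational bound is still small enough
    for the final estimate.\<close>
  have "c \<le> 3 / 8"
    unfolding c_def by (intro divide_left_mono) auto
  have p: "p holomorphic_on unit_disc"
    using assms(1) by (simp add: analytic_on_open)
  then have p': "deriv p holomorphic_on unit_disc"
    by (simp add: holomorphic_deriv)
  obtain w where w: "w holomorphic_on unit_disc" "w ` unit_disc \<subseteq> unit_disc" "w 0 = 0"
    and w_eq: "\<And>z. z \<in> unit_disc \<Longrightarrow>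
      z * deriv p z + z\<^sup>2 * deriv (deriv p) z = 3 * w z / (8 * complex_of_real (sqrt 2))"
    using assms(3) by (auto simp: subordinate_def analytic_on_open)
  have w_le: "norm (w z) \<le> norm z" if "z \<in> unit_disc" for z
    using Schwarz_Lemma(1)[of w z] w that by (auto simp: image_subset_iff)
  define q where "q z = z * deriv p z" for z
  have q: "q holomorphic_on unit_disc"
    unfolding q_def by (intro holomorphic_intros p')
  have q_deriv: "norm (z * deriv q z) \<le> c * norm z" if z: "z \<in> unit_disc" for z
  proof -
    have "(deriv p has_field_derivative deriv (deriv p) z) (at z)"
      using holomorphic_derivI[OF p' _ z] by simp
    then have "(q has_field_derivative (deriv p z + z * deriv (deriv p) z)) (at z)"
      unfolding q_def by (auto intro!: derivative_eq_intros)
    then have "z * deriv q z = 3 * w z / (8 * complex_of_real (sqrt 2))"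
      using w_eq[OF z] by (simp add: DERIV_imp_deriv power2_eq_square algebra_simps)
    then have "norm (z * deriv q z) = c * norm (w z)"
      by (simp add: norm_divide norm_mult c_def)
    then show ?thesis
      using w_le[OF z] \<open>c > 0\<close> by simp
  qed
  \<comment> \<open>As \<open>q 0 = 0\<close>, the bound on \<open>q\<close> is exactly what the
    same lemma requires of \<open>p\<close>.\<close>
  have "norm (z * deriv p z) \<le> c * norm z" if "z \<in> unit_disc" for z
    using norm_diff_le_of_norm_mult_deriv_le[OF q q_deriv that] by (simp add: q_def)
  from norm_diff_le_of_norm_mult_deriv_le[OF p this]
  have "norm (p z - 1) \<le> c * norm z" if "z \<in> unit_disc" for z
    using that assms(2) by simp
  moreover have "c * norm z \<le> 3 / 8" if "z \<in> unit_disc" for z :: complex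
    using mult_mono[OF \<open>c \<le> 3 / 8\<close>, of "norm z" 1] that by simp
  ultimately have p_near: "norm (p z - 1) \<le> 3 / 8" if "z \<in> unit_disc" for z
    using that by force
  have "(p z)\<^sup>2 - 1 \<in> unit_disc" if z: "z \<in> unit_disc" for z
  proof -
    have "norm (p z + 1) \<le> norm (p z - 1) + 2"
      using norm_triangle_ineq[of "p z - 1" 2] by (simp add: add.commute)
    \<comment> \<open>The product is \<open>(p z)\<^sup>2 - 1\<close>, and the right-hand side
      equals 57/64 < 1.\<close>
    then have "norm ((p z - 1) * (p z + 1)) \<le> 3 / 8 * (3 / 8 + 2)"
      unfolding norm_mult using p_near[OF z] by (intro mult_mono) auto
    then show ?thesis
      by (simp add: power2_eq_square algebra_simps)
  qed
  moreover have "csqrt (1 + ((p z)\<^sup>2 - 1)) = p z" if "z \<in> unit_disc" for z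
  proof -
    \<comment> \<open>The open right half-plane is where the principal root undoes squaring.\<close>
    have "Re (p z) > 0"
      using p_near[OF that] abs_Re_le_cmod[of "p z - 1"] by simp
    then show ?thesis
      by (simp add: csqrt_square)
  qed
  \<comment> \<open>Subordination also demands that the right-hand function be analytic, so
    \<open>1 + z\<close> must avoid the branch cut.\<close>
  moreover have "1 + z \<notin> \<real>\<^sub>\<le>\<^sub>0" if "z \<in> unit_disc" for z :: complex
    using that abs_Re_le_cmod[of z] by (auto simp: complex_nonpos_Reals_iff)
  then have "(\<lambda>z. csqrt (1 + z)) holomorphic_on unit_disc"
    by (intro holomorphic_intros) auto
  ultimately show ?thesis
    unfolding subordinate_def using p assms(2)
    by (intro conjI exI[of _ "\<lambda>z. (p z)\<^sup>2 - 1"])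
      (auto simp: analytic_on_open intro!: holomorphic_intros)
qed

end
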